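(* Let $R$ be the ring of $k\times k$ matrices over a field, and let $x_1,x_2\in R$. There exists a polynomial of the form $F(x)=x^2+a_1x+a_0$ with $a_0,a_1\in R$ such that $x_1$ and $x_2$ are roots of $F(x)$ if and only if the rank of the matrix $x_1-x_2$ equals the rank of the $2k\times k$ block matrix $$\begin{pmatrix} x_1-x_2\\ x_2^2-x_1^2\end{pmatrix},$$ obtained by appending the rows of the matrix $x_2^2-x_1^2$ below the rows of the matrix $x_1-x_2$.
   Context: Polynomials over $R$ are evaluated with coefficients on the left: for $F(x)=x^2+a_1x+a_0$ and $b\in R$, $F(b)=b^2+a_1b+a_0$, and $b$ is a root of $F(x)$ if $F(b)=0$. $F$ may have roots other than $x_1,x_2$. *)

theory Defs
  imports "HOL-Analysis.Analysis" "HOL-Computational_Algebra.Polynomial"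
begin

text \<open>
  The ring of square matrices over a field is the type \<open>'a^'n^'n\<close> with the product \<open>**\<close> and the
  unit \<open>mat 1\<close>. The class operations \<open>*\<close>, \<open>1\<close> and \<open>^\<close> on this type are entrywise, hence the
  separate power function, and \<open>poly\<close> cannot be used for evaluation; only the coefficient
  structure of the polynomial type is used.
\<close>

primrec matpow :: "'a::semiring_1^'n^'n \<Rightarrow> nat \<Rightarrow> 'a^'n^'n" where
  "matpow b 0 = mat 1"
| "matpow b (Suc i) = matpow b i ** b"

text \<open>Evaluation with the (noncommuting) coefficients on the left of the powers of the argument.\<close>

definition left_eval :: "('a::field^'n^'n) poly \<Rightarrow> 'a^'n^'n \<Rightarrow> 'a^'n^'n" where
  "left_eval F b = (\<Sum>i\<le>degree F. coeff F i ** matpow b i)"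

definition is_root :: "('a::field^'n^'n) poly \<Rightarrow> 'a^'n^'n \<Rightarrow> bool" where
  "is_root F b \<longleftrightarrow> left_eval F b = 0"

text \<open>
  The rows of \<open>A\<close> followed by the rows of \<open>B\<close>; the sum type \<open>'m + 'p\<close> indexes the rows.
\<close>

definition append_rows :: "'a^'n^'m \<Rightarrow> 'a^'n^'p \<Rightarrow> 'a^'n^('m + 'p)" where
  "append_rows A B = (\<chi> i. case i of Inl r \<Rightarrow> A $ r | Inr r \<Rightarrow> B $ r)"

lemma mat_1_neq_0: "(mat 1 :: 'a::field^'n^'n) \<noteq> 0"
proof
  assume "(mat 1 :: 'a^'n^'n) = 0"
  then have "(mat 1 :: 'a^'n^'n) $ i $ i = 0" for i by simp
  then show False by (simp add: mat_def)
qed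

lemma left_eval_monic_quadratic:
  fixes a0 a1 b :: "'a::field^'n^'n"
  shows "left_eval [:a0, a1, mat 1:] b = b ** b + a1 ** b + a0"
  by (simp add: left_eval_def mat_1_neq_0 numeral_2_eq_2 algebra_simps)

end

theory Submission
  imports Defs
begin

text \<open>
  Put \<open>D = x1 - x2\<close> and \<open>C = x2\<^sup>2 - x1\<^sup>2\<close>. Since \<open>a0\<close> is free, it can always be chosen so that \<open>x1\<close> is
  a root; the remaining condition, that \<open>F\<close> takes the same value at \<open>x1\<close> and \<open>x2\<close>, is the linear
  equation \<open>a1 D = C\<close>. As the rows of a product \<open>M D\<close> are arbitrary linear combinations of the rows
  of \<open>D\<close>, this equation is solvable exactly when every row of \<open>C\<close> lies in the row space of \<open>D\<close>.
  Both row spaces being finite-dimensional, that happens exactly when appending the rows of \<open>C\<close>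
  to \<open>D\<close> does not raise the dimension of the row space (\<open>left_multiple_iff_rank_append_rows\<close>).
\<close>

lemma vec_span_rows_eq_range:
  fixes A :: "'a::field^'n^'m"
  shows "vec.span (rows A) = range (\<lambda>v. v v* A)"
proof
  have image: "range (\<lambda>v. v v* A) = range ((*v) (transpose A))"
    by simp
  have "vec.subspace (range (\<lambda>v. v v* A))"
    unfolding image by (intro vec.subspace_image vec.subspace_UNIV)
  moreover have "row i A = axis i 1 v* A" for i
    by (simp add: vec_eq_iff row_def vector_matrix_mult_def axis_def if_distrib if_distribR
        cong: if_cong)
  then have "rows A \<subseteq> range (\<lambda>v. v v* A)"
    by (auto simp: rows_def)
  ultimately show "vec.span (rows A) \<subseteq> range (\<lambda>v. v v* A)"
    by (rule vec.span_minimal [rotated])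
next
  show "range (\<lambda>v. v v* A) \<subseteq> vec.span (rows A)"
    using matrix_vector_mult_in_columnspace_gen [of "transpose A"] by auto
qed

lemma matrix_diff_ldistrib:
  fixes M :: "'a::ring_1^'n^'m"
  shows "M ** (A - B) = M ** A - M ** B"
  by (simp add: vec_eq_iff matrix_matrix_mult_def right_diff_distrib sum_subtractf)

lemma row_matrix_matrix_mult: "row i (M ** A) = row i M v* A"
  by (simp add: vec_eq_iff row_def matrix_matrix_mult_def vector_matrix_mult_def mult.commute)

text \<open>
  The rows of \<open>M\<close> can be chosen independently of each other, so the matrix equation decouples into
  one condition per row of \<open>B\<close>: that row must be some \<open>v v* A\<close>, a combination of the rows of \<open>A\<close>.
\<close>

lemma left_multiple_iff_rows_in_span:
  fixes A :: "'a::field^'n^'m" and B :: "'a^'n^'p"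
  shows "(\<exists>M. M ** A = B) \<longleftrightarrow> rows B \<subseteq> vec.span (rows A)"
proof
  assume "\<exists>M. M ** A = B"
  then show "rows B \<subseteq> vec.span (rows A)"
    unfolding vec_span_rows_eq_range by (auto simp: rows_def row_matrix_matrix_mult)
next
  assume "rows B \<subseteq> vec.span (rows A)"
  then have "\<forall>i. \<exists>v. row i B = v v* A"
    unfolding vec_span_rows_eq_range by (auto simp: rows_def)
  then obtain f where f: "\<And>i. row i B = f i v* A"
    by metis
  have "row i ((\<chi> i. f i) ** A) = row i B" for i
    by (simp add: row_matrix_matrix_mult f) (simp add: row_def)
  then have "(\<chi> i. f i) ** A = B"
    by (simp add: vec_eq_iff row_def)
  then show "\<exists>M. M ** A = B" ..
qed

lemma rows_append_rows: "rows (append_rows A B) = rows A \<union> rows B"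
proof -
  have "row (Inl i) (append_rows A B) = row i A" "row (Inr j) (append_rows A B) = row j B" for i j
    by (simp_all add: row_def append_rows_def)
  then show ?thesis
    unfolding rows_def Setcompr_eq_image by (simp add: UNIV_sum image_Un image_image)
qed

text \<open>
  The row space of \<open>A\<close> is contained in that of the enlarged matrix, so equal dimensions force
  equal spaces. This is the solvability criterion for linear systems, for unknowns on the left
  and several right-hand sides at once.
\<close>

lemma left_multiple_iff_rank_append_rows:
  fixes A :: "'a::field^'n^'m" and B :: "'a^'n^'p"
  shows "(\<exists>M. M ** A = B) \<longleftrightarrow> rank A = rank (append_rows A B)"
proof -
  have "rows B \<subseteq> vec.span (rows A) \<longleftrightarrow> vec.dim (rows A) = vec.dim (rows A \<union> rows B)"
  proof
    assume "rows B \<subseteq> vec.span (rows A)"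
    then have "vec.span (rows A \<union> rows B) = vec.span (rows A)"
      by (intro vec.span_eq [THEN iffD2]) (auto intro: vec.span_base)
    then show "vec.dim (rows A) = vec.dim (rows A \<union> rows B)"
      by (metis vec.dim_span)
  next
    assume "vec.dim (rows A) = vec.dim (rows A \<union> rows B)"
    then have "vec.span (rows A) = vec.span (rows A \<union> rows B)"
      by (intro vec.dim_eq_span) auto
    then show "rows B \<subseteq> vec.span (rows A)"
      by (auto intro: vec.span_base)
  qed
  then show ?thesis
    by (simp add: left_multiple_iff_rows_in_span row_rank_def_gen rows_append_rows)
qed

theorem theorem5:
  fixes x1 x2 :: "'a::field^'n^'n"
  shows "(\<exists>a0 a1 :: 'a^'n^'n. is_root [:a0, a1, mat 1:] x1 \<and> is_root [:a0, a1, mat 1:] x2)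
    \<longleftrightarrow> rank (x1 - x2) = rank (append_rows (x1 - x2) (x2 ** x2 - x1 ** x1))"
proof -
  have "is_root [:a0, a1, mat 1:] x1 \<and> is_root [:a0, a1, mat 1:] x2 \<longleftrightarrow>
      a0 = - (x1 ** x1 + a1 ** x1) \<and> a1 ** (x1 - x2) = x2 ** x2 - x1 ** x1"
    for a0 a1 :: "'a^'n^'n"
    unfolding is_root_def left_eval_monic_quadratic matrix_diff_ldistrib
    by (auto simp: algebra_simps eq_neg_iff_add_eq_0) (metis add_left_cancel)
  then have "(\<exists>a0 a1 :: 'a^'n^'n. is_root [:a0, a1, mat 1:] x1 \<and> is_root [:a0, a1, mat 1:] x2)
      \<longleftrightarrow> (\<exists>a1. a1 ** (x1 - x2) = x2 ** x2 - x1 ** x1)"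
    by simp
  then show ?thesis
    by (simp only: left_multiple_iff_rank_append_rows)
qed

end
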